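(* The class of hyperbolically completely monotone (HCM) densities is not closed under Poisson mixing over the gamma shape parameter, even when the rate is fixed. More precisely, for all $a,b,\theta>0$, the function $p_{a,b,\theta}(x)=\frac{b^a e^{-\theta}}{\Gamma(a)}x^{a-1}e^{-bx}\,{}_0F_1(;a;b\theta x)$, $x>0$, satisfies $$p_{a,b,\theta}(x)=e^{-\theta}\sum_{m=0}^{\infty}\frac{\theta^m}{m!}\,\gamma_{a+m,b}(x),\qquad x>0,$$ and is therefore a Poisson mixture of the gamma densities $\gamma_{a+m,b}$ ($m\ge 0$), each of which is HCM, but $p_{a,b,\theta}$ is not HCM.
   Context: For $\alpha,b>0$, $\gamma_{\alpha,b}(x)=\frac{b^\alpha}{\Gamma(\alpha)}x^{\alpha-1}e^{-bx}$, $x>0$, is the gamma density with shape $\alpha$ and rate $b$. Also ${}_0F_1(;a;z)=\sum_{m=0}^{\infty}\frac{z^m}{m!\,(a)_m}$ with $(a)_m=\Gamma(a+m)/\Gamma(a)$. A positive function $f$ on $(0,\infty)$ is hyperbolically completely monotone (HCM) if for every $u>0$ the function $v\mapsto f(uv)f(u/v)$ is completely monotone as a function of $w=v+v^{-1}$ on $(2,\infty)$; that is, for every $u>0$ the function $$H_u(w)=f(u\,v(w))\,f(u/v(w)),\qquad v(w)=\frac{w+\sqrt{w^2-4}}{2},\qquad w>2,$$ has derivatives of all orders on $(2,\infty)$ and satisfies $(-1)^n H_u^{(n)}(w)\ge 0$ for all integers $n\ge 0$ and all $w>2$. *)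

theory Defs
  imports "HOL-Analysis.Analysis"
begin

(* All functions on (0, \<infinity>) are modelled as total functions real \<Rightarrow> real; every notion below
   only looks at their values at positive arguments. *)

definition gamma_density :: "real \<Rightarrow> real \<Rightarrow> real \<Rightarrow> real" where
  "gamma_density \<alpha> b x = b powr \<alpha> / Gamma \<alpha> * x powr (\<alpha> - 1) * exp (- b * x)"

definition hyp_0F1 :: "real \<Rightarrow> real \<Rightarrow> real" where
  "hyp_0F1 a z = (\<Sum>m. z ^ m / (fact m * pochhammer a m))"

lemma hyp_0F1_Gamma:
  assumes "a > 0"
  shows "hyp_0F1 a z = (\<Sum>m. z ^ m / (fact m * (Gamma (a + real m) / Gamma a)))"
proof -
  have "a \<notin> \<int>\<^sub>\<le>\<^sub>0" using assms by (auto elim!: nonpos_Ints_cases)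
  then show ?thesis by (simp add: hyp_0F1_def pochhammer_Gamma)
qed

(* S is meant to be open, so that iterating deriv at points of S only depends on f on S. *)
definition completely_monotone_on :: "real set \<Rightarrow> (real \<Rightarrow> real) \<Rightarrow> bool" where
  "completely_monotone_on S f \<longleftrightarrow>
     (\<forall>n. \<forall>w\<in>S. (deriv ^^ n) f differentiable (at w) \<and> (-1) ^ n * (deriv ^^ n) f w \<ge> 0)"

(* The root v > 1 of v + 1/v = w, for w > 2. *)
definition hcm_v :: "real \<Rightarrow> real" where
  "hcm_v w = (w + sqrt (w\<^sup>2 - 4)) / 2"

definition HCM :: "(real \<Rightarrow> real) \<Rightarrow> bool" where
  "HCM f \<longleftrightarrow> (\<forall>x>0. f x > 0) \<and>
     (\<forall>u>0. completely_monotone_on {2<..} (\<lambda>w. f (u * hcm_v w) * f (u / hcm_v w)))"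

definition prob_density_pos :: "(real \<Rightarrow> real) \<Rightarrow> bool" where
  "prob_density_pos f \<longleftrightarrow> (\<forall>x>0. f x \<ge> 0) \<and> (f has_integral 1) {0<..}"

definition p_mix :: "real \<Rightarrow> real \<Rightarrow> real \<Rightarrow> real \<Rightarrow> real" where
  "p_mix a b \<theta> x =
     b powr a * exp (- \<theta>) / Gamma a * x powr (a - 1) * exp (- b * x) * hyp_0F1 a (b * \<theta> * x)"

end

theory Submission
  imports Defs "HOL-Computational_Algebra.Polynomial"
begin

text \<open>With \<open>u = 1\<close> and \<open>c = b\<theta>\<close>, the function that would have to be completely monotone is a constant
  multiple of \<open>exp (- b w) G(w)\<close>, where \<open>G(w) = F(c v) F(c / v)\<close> and \<open>F\<close> is the hypergeometric factor.
  Completely monotone functions are log-convex, and the exponential factor is log-affine, so \<open>G\<close> would be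
  log-convex. Since \<open>G\<close> is unbounded, it would then grow geometrically along some arithmetic
  progression. But \<open>F\<close> is an entire function of order \<open>1/2\<close>, so \<open>G\<close> grows more slowly than every
  exponential.\<close>

section \<open>Log-convexity of completely monotone functions\<close>

text \<open>Carrying the whole sequence of derivatives explicitly lets differences and exponentials
  be treated termwise, without computing iterates of \<open>deriv\<close>.\<close>

definition cm_family :: "real \<Rightarrow> (nat \<Rightarrow> real \<Rightarrow> real) \<Rightarrow> bool" where
  "cm_family c F \<longleftrightarrow>
     (\<forall>n. \<forall>x>c. (F n has_real_derivative F (Suc n) x) (at x) \<and> 0 \<le> (-1) ^ n * F n x)"

lemma cm_family_deriv:
  assumes "completely_monotone_on {c<..} f"
  shows "cm_family c (\<lambda>n. (deriv ^^ n) f)"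
  using assms unfolding cm_family_def completely_monotone_on_def
  by (auto simp: DERIV_deriv_iff_real_differentiable)

text \<open>The half-line is open, so agreement on it is agreement near each of its points;
  induction on the order then carries it over to all derivatives.\<close>

lemma completely_monotone_onI_cm_family:
  assumes "cm_family c F" "\<And>x. x > c \<Longrightarrow> F 0 x = f x"
  shows "completely_monotone_on {c<..} f"
proof -
  have eq: "(deriv ^^ n) f x = F n x" if "x > c" for n x
    using that
  proof (induction n arbitrary: x)
    case 0
    then show ?case using assms(2) by simp
  next
    case (Suc n)
    have "eventually (\<lambda>y. y \<in> {c<..}) (nhds x)"
      using Suc.prems by (intro eventually_nhds_in_open) auto
    then have "eventually (\<lambda>y. (deriv ^^ n) f y = F n y) (nhds x)"
      by eventually_elim (use Suc.IH in auto)
    then have "deriv ((deriv ^^ n) f) x = deriv (F n) x"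
      by (intro deriv_cong_ev) auto
    also have "\<dots> = F (Suc n) x"
      using assms(1) Suc.prems by (intro DERIV_imp_deriv) (auto simp: cm_family_def)
    finally show ?case by simp
  qed
  have "(deriv ^^ n) f differentiable (at x)" if "x > c" for n x
  proof -
    have "(F n has_real_derivative F (Suc n) x) (at x)"
      using assms(1) that by (auto simp: cm_family_def)
    then have "((deriv ^^ n) f has_real_derivative F (Suc n) x) (at x)"
      by (rule DERIV_cong_ev[THEN iffD1, rotated -1])
        (use that eq in \<open>auto intro!: eventually_mono[OF eventually_nhds_in_open[of "{c<..}"]]\<close>)
    then show ?thesis
      using real_differentiable_def by blast
  qed
  then show ?thesis
    using assms(1) eq by (auto simp: completely_monotone_on_def cm_family_def)
qed

text \<open>The derivative of \<open>(-1) ^ n * F n\<close> is minus the nonnegative quantity of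
  order \<open>Suc n\<close>, so this function decreases and its difference over a step
  \<open>h\<close> is nonnegative. Iteration gives the signs of all finite differences.\<close>

lemma cm_family_shift_diff:
  assumes "cm_family c F" "h > 0"
  shows "cm_family c (\<lambda>n x. F n x - F n (x + h))"
  unfolding cm_family_def
proof (intro allI impI conjI)
  fix n x assume x: "(x::real) > c"
  have D: "(F n has_real_derivative F (Suc n) y) (at y)" if "y > c" for n y
    using assms(1) that by (auto simp: cm_family_def)
  show "((\<lambda>x. F n x - F n (x + h)) has_real_derivative F (Suc n) x - F (Suc n) (x + h)) (at x)"
    using x assms(2) DERIV_shift[of "F n" "F (Suc n) (x + h)" x h] D[of "x + h" n]
    by (intro DERIV_diff D) auto
  have "(-1) ^ n * F n (x + h) \<le> (-1) ^ n * F n x"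
  proof (rule DERIV_nonpos_imp_nonincreasing[where f = "\<lambda>x. (-1) ^ n * F n x"])
    show "x \<le> x + h" using assms(2) by simp
    fix y assume "x \<le> y" "y \<le> x + h"
    then have "y > c" using x by simp
    then have "((\<lambda>x. (-1) ^ n * F n x) has_real_derivative (-1) ^ n * F (Suc n) y) (at y)"
      by (intro DERIV_cmult D)
    moreover have "(-1) ^ n * F (Suc n) y \<le> 0"
    proof -
      have "0 \<le> (-1) ^ Suc n * F (Suc n) y"
        using assms(1) \<open>y > c\<close> unfolding cm_family_def by blast
      then show ?thesis by simp
    qed
    ultimately show "\<exists>z. ((\<lambda>x. (-1) ^ n * F n x) has_real_derivative z) (at y) \<and> z \<le> 0"
      by blast
  qed
  then show "0 \<le> (-1) ^ n * (F n x - F n (x + h))"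
    by (simp add: algebra_simps)
qed

text \<open>The moment functional of Hausdorff: linear in \<open>p\<close>, it sends X^i to
  \<open>f (w + real i * h)\<close>. If \<open>f\<close> is the Laplace transform of a measure in t,
  it integrates \<open>p\<close> at X = exp(-h t) against exp(-w t) times that measure.\<close>

definition sample_functional :: "real \<Rightarrow> (real \<Rightarrow> real) \<Rightarrow> real \<Rightarrow> real poly \<Rightarrow> real" where
  "sample_functional h f w p = (\<Sum>i\<le>degree p. coeff p i * f (w + real i * h))"

text \<open>Coefficients beyond the degree vanish. A common bound \<open>N\<close> makes linearity
  provable even where the degree of a sum drops.\<close>

lemma sample_functional_eq:
  assumes "degree p \<le> N"
  shows "sample_functional h f w p = (\<Sum>i\<le>N. coeff p i * f (w + real i * h))"
  unfolding sample_functional_def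
  by (rule sum.mono_neutral_left) (use assms in \<open>auto simp: coeff_eq_0\<close>)

lemma sample_functional_add:
  "sample_functional h f w (p + q) = sample_functional h f w p + sample_functional h f w q"
proof -
  define N where "N = max (degree p) (degree q)"
  have "degree p \<le> N" "degree q \<le> N" "degree (p + q) \<le> N"
    by (auto simp: N_def degree_add_le_max)
  then show ?thesis
    by (simp add: sample_functional_eq[of _ N] sum.distrib algebra_simps)
qed

lemma sample_functional_smult:
  "sample_functional h f w (smult a p) = a * sample_functional h f w p"
  by (subst (1 2) sample_functional_eq[of _ "degree p"])
    (auto simp: degree_smult_le sum_distrib_left mult.assoc)

lemma sample_functional_sum:
  "sample_functional h f w (\<Sum>i\<in>A. p i) = (\<Sum>i\<in>A. sample_functional h f w (p i))"
proof (induction A rule: infinite_finite_induct)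
  case (insert x A)
  then show ?case by (simp add: sample_functional_add)
qed (simp_all add: sample_functional_def)

lemma sample_functional_monom:
  "sample_functional h f w (monom a j) = a * f (w + real j * h)"
proof -
  have "sample_functional h f w (monom a j) = (\<Sum>i\<le>j. coeff (monom a j) i * f (w + real i * h))"
    by (rule sample_functional_eq) (rule degree_monom_le)
  also have "\<dots> = (\<Sum>i\<in>{j}. coeff (monom a j) i * f (w + real i * h))"
    by (rule sum.mono_neutral_right) auto
  finally show ?thesis by simp
qed

lemma sample_functional_pCons:
  "sample_functional h f w (pCons 0 p) = sample_functional h (\<lambda>x. f (x + h)) w p"
proof -
  have "sample_functional h f w (pCons 0 p) =
          (\<Sum>i\<le>Suc (degree p). coeff (pCons 0 p) i * f (w + real i * h))"
    by (rule sample_functional_eq) (rule degree_pCons_le)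
  also have "\<dots> = (\<Sum>i\<le>degree p. coeff p i * f (w + real (Suc i) * h))"
    by (subst sum.atMost_Suc_shift) simp
  also have "\<dots> = sample_functional h (\<lambda>x. f (x + h)) w p"
    by (simp add: sample_functional_def algebra_simps)
  finally show ?thesis .
qed

text \<open>Multiplication by X shifts \<open>f\<close> by \<open>h\<close>, so multiplication by 1
  - X becomes the difference operator of \<open>cm_family_shift_diff\<close>.\<close>

lemma sample_functional_one_minus_X:
  "sample_functional h f w ([:1, -1:] * p) = sample_functional h (\<lambda>x. f x - f (x + h)) w p"
proof -
  have "[:1, -1:] * p = p + smult (-1) (pCons 0 p)"
    by simp
  then have "sample_functional h f w ([:1, -1:] * p) =
      sample_functional h f w p - sample_functional h (\<lambda>x. f (x + h)) w p"
    by (simp only: sample_functional_add sample_functional_smult sample_functional_pCons)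
  also have "\<dots> = sample_functional h (\<lambda>x. f x - f (x + h)) w p"
    by (simp add: sample_functional_def sum_subtractf right_diff_distrib)
  finally show ?thesis .
qed

text \<open>Each factor 1 - X is traded for a difference of the family, which is again a
  \<open>cm_family\<close>; after \<open>m\<close> trades a single sample at
  \<open>w + real j * h\<close> is left. Hence the generalisation over \<open>F\<close> in the
  induction.\<close>

lemma sample_functional_nonneg:
  assumes "cm_family c F" "h > 0" "w > c"
  shows "0 \<le> sample_functional h (F 0) w ([:1, -1:] ^ m * monom 1 j)"
  using assms(1)
proof (induction m arbitrary: F)
  case 0
  have "w + real j * h > c"
    using assms(2,3) mult_nonneg_nonneg[of "real j" h] by linarith
  then have "0 \<le> (-1) ^ 0 * F 0 (w + real j * h)"
    using 0 unfolding cm_family_def by blast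
  then show ?case by (simp add: sample_functional_monom)
next
  case (Suc m)
  have "0 \<le> sample_functional h (\<lambda>x. F 0 x - F 0 (x + h)) w ([:1, -1:] ^ m * monom 1 j)"
    using Suc.IH[OF cm_family_shift_diff[OF Suc.prems assms(2)]] by simp
  then show ?case
    by (simp only: power_Suc mult.assoc sample_functional_one_minus_X)
qed

section \<open>Bernstein polynomials as formal polynomials, and the resulting quadratic form\<close>

definition Bernstein_poly :: "nat \<Rightarrow> nat \<Rightarrow> real poly" where
  "Bernstein_poly n k = smult (of_nat (n choose k)) ([:1, -1:] ^ (n - k) * monom 1 k)"

lemma poly_Bernstein_poly: "poly (Bernstein_poly n k) x = Bernstein n k x"
  by (simp add: Bernstein_poly_def Bernstein_def poly_monom algebra_simps)

text \<open>Real polynomials with equal values are equal, so this and the next two identities follow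
  from the classical moment identities for \<open>Bernstein\<close>.\<close>

lemma sum_Bernstein_poly: "(\<Sum>k\<le>n. Bernstein_poly n k) = monom 1 0"
  by (rule poly_eq_poly_eq_iff[THEN iffD1, OF ext])
    (simp add: poly_sum poly_Bernstein_poly poly_monom)

lemma sum_k_Bernstein_poly:
  "(\<Sum>k\<le>n. smult (real k) (Bernstein_poly n k)) = monom (real n) 1"
  by (rule poly_eq_poly_eq_iff[THEN iffD1, OF ext])
    (simp add: poly_sum poly_Bernstein_poly poly_monom)

lemma sum_kk_Bernstein_poly:
  "(\<Sum>k\<le>n. smult (real k * (real k - 1)) (Bernstein_poly n k)) = monom (real n * (real n - 1)) 2"
  by (rule poly_eq_poly_eq_iff[THEN iffD1, OF ext])
    (simp add: poly_sum poly_Bernstein_poly poly_monom)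

text \<open>The Bernstein weights \<open>W k\<close> form a positive measure on \<open>{0..n}\<close> whose zeroth moment and first two
  factorial moments are \<open>f w\<close>, \<open>n f (w + h)\<close> and \<open>n (n - 1) f (w + 2 h)\<close>. Rescaling by \<open>1 / n\<close> and letting
  \<open>n\<close> tend to infinity turns the positivity of the integral of \<open>(k - n s)\<^sup>2\<close> into the
  claim; this replaces Bernstein's representation theorem.\<close>

lemma cm_family_quadratic_form:
  assumes "cm_family c F" "h > 0" "w > c"
  shows "0 \<le> F 0 (w + 2 * h) - 2 * s * F 0 (w + h) + s\<^sup>2 * F 0 w"
proof -
  let ?L = "sample_functional h (F 0) w"
  have bound: "0 \<le> (1 - 1 / real n) * F 0 (w + 2 * h) + 1 / real n * F 0 (w + h)
      - 2 * s * F 0 (w + h) + s\<^sup>2 * F 0 w" if "n > 0" for n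
  proof -
    define W where "W k = ?L (Bernstein_poly n k)" for k
    have W_nonneg: "0 \<le> W k" for k
      unfolding W_def Bernstein_poly_def sample_functional_smult
      using sample_functional_nonneg[OF assms] by simp
    have m0: "(\<Sum>k\<le>n. W k) = F 0 w"
      unfolding W_def sample_functional_sum[symmetric] sum_Bernstein_poly sample_functional_monom
      by simp
    have m1: "(\<Sum>k\<le>n. real k * W k) = real n * F 0 (w + h)"
      unfolding W_def sample_functional_smult[symmetric] sample_functional_sum[symmetric]
        sum_k_Bernstein_poly sample_functional_monom by simp
    have m2: "(\<Sum>k\<le>n. real k * (real k - 1) * W k) = real n * (real n - 1) * F 0 (w + 2 * h)"
      unfolding W_def sample_functional_smult[symmetric] sample_functional_sum[symmetric]
        sum_kk_Bernstein_poly sample_functional_monom by simp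
    have "0 \<le> (\<Sum>k\<le>n. (real k - real n * s)\<^sup>2 * W k)"
      by (intro sum_nonneg mult_nonneg_nonneg W_nonneg) auto
    \<comment> \<open>The square is written in factorial moments through k^2 = k (k - 1) + k, to
      match \<open>m0\<close>, \<open>m1\<close> and \<open>m2\<close>.\<close>
    also have "\<dots> = (\<Sum>k\<le>n. real k * (real k - 1) * W k + real k * W k
        - (2 * real n * s) * (real k * W k) + (real n * s)\<^sup>2 * W k)"
      by (intro sum.cong refl) (simp add: algebra_simps power2_eq_square)
    also have "\<dots> = real n * (real n - 1) * F 0 (w + 2 * h) + real n * F 0 (w + h)
        - (2 * real n * s) * (real n * F 0 (w + h)) + (real n * s)\<^sup>2 * F 0 w"
      by (simp only: sum.distrib sum_subtractf sum_distrib_left[symmetric] m0 m1 m2)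
    also have "\<dots> = (real n)\<^sup>2 * ((1 - 1 / real n) * F 0 (w + 2 * h) + 1 / real n * F 0 (w + h)
      - 2 * s * F 0 (w + h) + s\<^sup>2 * F 0 w)"
      using that by (simp add: field_simps power2_eq_square)
    finally show ?thesis
      using that by (simp add: zero_le_mult_iff)
  qed
  have "(\<lambda>n. (1 - 1 / real n) * F 0 (w + 2 * h) + 1 / real n * F 0 (w + h)
      - 2 * s * F 0 (w + h) + s\<^sup>2 * F 0 w)
      \<longlonglongrightarrow> (1 - 0) * F 0 (w + 2 * h) + 0 * F 0 (w + h) - 2 * s * F 0 (w + h) + s\<^sup>2 * F 0 w"
    by (intro tendsto_intros lim_1_over_n)
  then have "0 \<le> (1 - 0) * F 0 (w + 2 * h) + 0 * F 0 (w + h) - 2 * s * F 0 (w + h) + s\<^sup>2 * F 0 w"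
    by (rule tendsto_lowerbound)
      (use bound in \<open>auto intro!: eventually_mono[OF eventually_gt_at_top[of "0::nat"]]\<close>)
  then show ?thesis by simp
qed

lemma completely_monotone_on_log_convex:
  assumes "completely_monotone_on {c<..} f" "h > 0" "w > c" "f w > 0"
  shows "(f (w + h))\<^sup>2 \<le> f w * f (w + 2 * h)"
proof -
  \<comment> \<open>This \<open>s\<close> minimises the quadratic form, whose nonnegativity then
    becomes the discriminant inequality.\<close>
  define s where "s = f (w + h) / f w"
  have s: "s * f w = f (w + h)"
    using assms(4) by (simp add: s_def)
  have "0 \<le> f (w + 2 * h) - 2 * s * f (w + h) + s\<^sup>2 * f w"
    using cm_family_quadratic_form[OF cm_family_deriv[OF assms(1)] assms(2,3)] by simp
  then have "0 \<le> f w * (f (w + 2 * h) - 2 * s * f (w + h) + s\<^sup>2 * f w)"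
    using assms(4) by simp
  also have "\<dots> = f w * f (w + 2 * h) - 2 * (s * f w) * f (w + h) + (s * f w)\<^sup>2"
    by (simp add: algebra_simps power2_eq_square)
  also have "\<dots> = f w * f (w + 2 * h) - (f (w + h))\<^sup>2"
    by (simp add: s power2_eq_square)
  finally show ?thesis by simp
qed

text \<open>Log-convexity makes the ratios of consecutive terms nondecreasing, so every ratio is at
  least the first one.\<close>

lemma log_convex_sequence_growth:
  fixes g :: "nat \<Rightarrow> real"
  assumes pos: "\<And>k. g k > 0" and convex: "\<And>k. (g (Suc k))\<^sup>2 \<le> g k * g (Suc (Suc k))"
  shows "g 0 * (g 1 / g 0) ^ k \<le> g k"
proof -
  define \<rho> where "\<rho> = g 1 / g 0"
  have step: "\<rho> * g k \<le> g (Suc k)" for k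
  proof (induction k)
    case 0
    show ?case using pos[of 0] by (simp add: \<rho>_def)
  next
    case (Suc k)
    have "(\<rho> * g k) * g (Suc k) \<le> g (Suc k) * g (Suc k)"
      using Suc pos[of "Suc k"] by (intro mult_right_mono) auto
    also have "\<dots> \<le> g k * g (Suc (Suc k))"
      using convex[of k] by (simp add: power2_eq_square)
    finally have "g k * (\<rho> * g (Suc k)) \<le> g k * g (Suc (Suc k))"
      by (simp add: mult_ac)
    then show ?case using pos[of k] by simp
  qed
  have "\<rho> \<ge> 0" using pos[of 0] pos[of 1] by (simp add: \<rho>_def)
  have "g 0 * \<rho> ^ k \<le> g k"
  proof (induction k)
    case (Suc k)
    have "g 0 * \<rho> ^ Suc k = \<rho> * (g 0 * \<rho> ^ k)" by simp
    also have "\<dots> \<le> \<rho> * g k" using Suc \<open>\<rho> \<ge> 0\<close> by (intro mult_left_mono)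
    finally show ?case using step[of k] by simp
  qed simp
  then show ?thesis by (simp add: \<rho>_def)
qed

section \<open>The hypergeometric series\<close>

lemma pochhammer_ge_power:
  fixes a :: real
  assumes "a > 0"
  shows "a ^ m \<le> pochhammer a m"
proof (induction m)
  case (Suc m)
  have "a ^ m * a \<le> pochhammer a m * (a + real m)"
    using Suc assms by (intro mult_mono) (auto intro: order_trans[rotated])
  then show ?case by (simp add: pochhammer_Suc mult.commute)
qed simp

lemma summable_power_over_pochhammer:
  fixes a :: real
  assumes "a > 0"
  shows "summable (\<lambda>m. x ^ m / pochhammer a m)"
\<comment> \<open>Consecutive terms have absolute ratio |x| / (a + m), which is at most 1/2 from
  this index on.\<close>
proof (rule summable_ratio_test[where c = "1/2" and N = "nat \<lceil>2 * \<bar>x\<bar>\<rceil>"])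
  fix m assume "m \<ge> nat \<lceil>2 * \<bar>x\<bar>\<rceil>"
  then have m: "2 * \<bar>x\<bar> \<le> a + real m" using assms by linarith
  have p: "pochhammer a m > 0" using assms by (rule pochhammer_pos)
  have "norm (x ^ Suc m / pochhammer a (Suc m)) = (\<bar>x\<bar> / (a + real m)) * norm (x ^ m / pochhammer a m)"
    using p assms by (simp add: pochhammer_Suc abs_mult power_abs)
  also have "\<dots> \<le> 1/2 * norm (x ^ m / pochhammer a m)"
    using m assms by (intro mult_right_mono) (auto simp: field_simps)
  finally show "norm (x ^ Suc m / pochhammer a (Suc m)) \<le> 1/2 * norm (x ^ m / pochhammer a m)" .
qed simp

lemma summable_hyp_0F1:
  fixes a z :: real
  assumes "a > 0"
  shows "summable (\<lambda>m. z ^ m / (fact m * pochhammer a m))"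
proof -
  have "summable (\<lambda>m. (\<bar>z\<bar> / a) ^ m / fact m)"
    using summable_exp[of "\<bar>z\<bar> / a"] by (simp add: divide_inverse mult.commute)
  then show ?thesis
  proof (rule summable_comparison_test'[where N = 0])
    fix m :: nat
    have "norm (z ^ m / (fact m * pochhammer a m)) = \<bar>z\<bar> ^ m / (fact m * pochhammer a m)"
      using pochhammer_pos[OF assms, of m] by (simp add: power_abs abs_mult)
    also have "\<dots> \<le> \<bar>z\<bar> ^ m / (fact m * a ^ m)"
      using pochhammer_ge_power[OF assms, of m] pochhammer_pos[OF assms, of m] assms
      by (intro divide_left_mono mult_left_mono) auto
    also have "\<dots> = (\<bar>z\<bar> / a) ^ m / fact m"
      by (simp add: power_divide)
    finally show "norm (z ^ m / (fact m * pochhammer a m)) \<le> (\<bar>z\<bar> / a) ^ m / fact m" .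
  qed
qed

text \<open>All terms are nonnegative, so the first two bound the series from below; this makes it
  unbounded.\<close>

lemma hyp_0F1_ge:
  assumes "a > 0" "z \<ge> 0"
  shows "1 + z / a \<le> hyp_0F1 a z"
proof -
  have "(\<Sum>m<2. z ^ m / (fact m * pochhammer a m)) \<le> hyp_0F1 a z"
    unfolding hyp_0F1_def
    by (rule sum_le_suminf[OF summable_hyp_0F1[OF assms(1)]])
      (use assms in \<open>auto intro!: divide_nonneg_nonneg mult_nonneg_nonneg less_imp_le[OF pochhammer_pos]\<close>)
  then show ?thesis by (simp add: numeral_2_eq_2)
qed

lemma hyp_0F1_mono:
  assumes "a > 0" "0 \<le> y" "y \<le> z"
  shows "hyp_0F1 a y \<le> hyp_0F1 a z"
  unfolding hyp_0F1_def
  using assms pochhammer_pos[OF assms(1)]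
  by (intro suminf_le summable_hyp_0F1 divide_right_mono power_mono)
    (auto intro!: mult_nonneg_nonneg less_imp_le)

text \<open>The factors \<open>1 / pochhammer a m\<close> decay faster than any geometric sequence,
  so \<open>(1 / \<epsilon>) ^ m / pochhammer a m\<close> stays below some \<open>K\<close>. The
  series is then dominated termwise by \<open>K\<close> times that of
  \<open>exp (\<epsilon> * z)\<close>.\<close>

lemma hyp_0F1_subexponential:
  assumes "a > 0" "\<epsilon> > 0"
  obtains K where "K > 0" "\<And>z. z \<ge> 0 \<Longrightarrow> hyp_0F1 a z \<le> K * exp (\<epsilon> * z)"
proof -
  have "Bseq (\<lambda>m. (1 / \<epsilon>) ^ m / pochhammer a m)"
    using summable_LIMSEQ_zero[OF summable_power_over_pochhammer[OF assms(1)]]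
    by (intro convergent_imp_Bseq convergentI)
  then obtain K where "K > 0" and K: "\<And>m. norm ((1 / \<epsilon>) ^ m / pochhammer a m) \<le> K"
    by (auto simp: Bseq_def)
  have "hyp_0F1 a z \<le> K * exp (\<epsilon> * z)" if "z \<ge> 0" for z
  proof -
    have sums: "(\<lambda>m. K * ((\<epsilon> * z) ^ m / fact m)) sums (K * exp (\<epsilon> * z))"
      using exp_converges[of "\<epsilon> * z"] by (intro sums_mult) (simp add: field_simps)
    have "hyp_0F1 a z \<le> (\<Sum>m. K * ((\<epsilon> * z) ^ m / fact m))"
      unfolding hyp_0F1_def
    proof (rule suminf_le)
      fix m
      have "(1 / \<epsilon>) ^ m / pochhammer a m \<le> K" using K[of m] unfolding real_norm_def by linarith
      then have "((\<epsilon> * z) ^ m / fact m) * ((1 / \<epsilon>) ^ m / pochhammer a m) \<le> ((\<epsilon> * z) ^ m / fact m) * K"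
        using assms that by (intro mult_left_mono) auto
      moreover have "((\<epsilon> * z) ^ m / fact m) * ((1 / \<epsilon>) ^ m / pochhammer a m)
          = z ^ m / (fact m * pochhammer a m)"
        using assms by (simp add: power_mult_distrib power_divide)
      ultimately show "z ^ m / (fact m * pochhammer a m) \<le> K * ((\<epsilon> * z) ^ m / fact m)"
        by (simp only: mult.commute[of K])
    qed (use summable_hyp_0F1[OF assms(1)] sums_summable[OF sums] in auto)
    then show ?thesis using sums_unique[OF sums] by simp
  qed
  with \<open>K > 0\<close> show thesis using that by blast
qed

section \<open>Gamma densities and their Poisson mixture\<close>

lemma hcm_v_gt_1:
  assumes "w > 2"
  shows "hcm_v w > 1"
proof -
  have "w\<^sup>2 \<ge> 4" using assms power_mono[of 2 w 2] by simp
  then have "sqrt (w\<^sup>2 - 4) \<ge> 0" by simp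
  then have "w + sqrt (w\<^sup>2 - 4) > 2" using assms by linarith
  then show ?thesis by (simp add: hcm_v_def)
qed

lemma hcm_v_bounds:
  assumes "w > 2"
  shows "w / 2 \<le> hcm_v w" "hcm_v w \<le> w"
proof -
  have "w\<^sup>2 \<ge> 4" using assms power_mono[of 2 w 2] by simp
  then show "w / 2 \<le> hcm_v w" by (simp add: hcm_v_def)
  have "sqrt (w\<^sup>2 - 4) \<le> sqrt (w\<^sup>2)" by (intro real_sqrt_le_mono) simp
  then show "hcm_v w \<le> w" using assms by (simp add: hcm_v_def)
qed

lemma hcm_v_add_inverse:
  assumes "w > 2"
  shows "hcm_v w + 1 / hcm_v w = w"
proof -
  have "w\<^sup>2 \<ge> 4" using assms power_mono[of 2 w 2] by simp
  then have s: "(sqrt (w\<^sup>2 - 4))\<^sup>2 = w\<^sup>2 - 4" by simp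
  have "hcm_v w * hcm_v w + 1 = w * hcm_v w"
    using s by (simp add: hcm_v_def power2_eq_square field_simps)
  then show ?thesis using hcm_v_gt_1[OF assms] by (simp add: field_simps)
qed

lemma gamma_density_pos:
  assumes "\<alpha> > 0" "b > 0" "x > 0"
  shows "gamma_density \<alpha> b x > 0"
  using assms by (simp add: gamma_density_def Gamma_real_pos)

text \<open>The powers of \<open>v\<close> cancel and the exponents add up to a multiple of
  \<open>v + 1 / v\<close>, so in the variable w the product is a constant times a decaying
  exponential.\<close>

lemma gamma_density_mult:
  assumes "u > 0" "v > 0"
  shows "gamma_density \<alpha> b (u * v) * gamma_density \<alpha> b (u / v) =
    (b powr \<alpha> / Gamma \<alpha> * u powr (\<alpha> - 1))\<^sup>2 * exp (- (b * u) * (v + 1 / v))"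
proof -
  have "(u * v) powr (\<alpha> - 1) * (u / v) powr (\<alpha> - 1) = (u powr (\<alpha> - 1))\<^sup>2"
    using assms by (simp add: powr_mult powr_divide power2_eq_square)
  moreover have "exp (- b * (u * v)) * exp (- b * (u / v)) = exp (- (b * u) * (v + 1 / v))"
    using assms by (simp add: algebra_simps flip: exp_add)
  moreover have "gamma_density \<alpha> b (u * v) * gamma_density \<alpha> b (u / v) =
     (b powr \<alpha> / Gamma \<alpha>)\<^sup>2 * ((u * v) powr (\<alpha> - 1) * (u / v) powr (\<alpha> - 1)) *
       (exp (- b * (u * v)) * exp (- b * (u / v)))"
    by (simp add: gamma_density_def power2_eq_square)
  ultimately show ?thesis
    by (simp only: power_mult_distrib)
qed

lemma cm_family_exp:
  assumes "C \<ge> 0" "\<beta> \<ge> 0"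
  shows "cm_family c (\<lambda>n x. (- \<beta>) ^ n * (C * exp (- \<beta> * x)))"
proof -
  have "(-1) ^ n * ((- \<beta>) ^ n * (C * exp (- \<beta> * x))) = \<beta> ^ n * (C * exp (- \<beta> * x))" for n x
    by (simp add: mult.assoc[symmetric] power_mult_distrib[symmetric])
  then have "0 \<le> (-1) ^ n * ((- \<beta>) ^ n * (C * exp (- \<beta> * x)))" for n x
    using assms by (simp only: mult_nonneg_nonneg zero_le_power exp_ge_zero)
  moreover have "((\<lambda>x. (- \<beta>) ^ n * (C * exp (- \<beta> * x))) has_real_derivative
      (- \<beta>) ^ Suc n * (C * exp (- \<beta> * x))) (at x)" for n x
    by (auto intro!: derivative_eq_intros)
  ultimately show ?thesis
    unfolding cm_family_def by blast
qed

lemma HCM_gamma_density: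
  assumes "\<alpha> > 0" "b > 0"
  shows "HCM (gamma_density \<alpha> b)"
  unfolding HCM_def
proof (intro conjI allI impI)
  fix u :: real assume u: "u > 0"
  define C where "C = (b powr \<alpha> / Gamma \<alpha> * u powr (\<alpha> - 1))\<^sup>2"
  show "completely_monotone_on {2<..}
          (\<lambda>w. gamma_density \<alpha> b (u * hcm_v w) * gamma_density \<alpha> b (u / hcm_v w))"
  proof (rule completely_monotone_onI_cm_family)
    show "cm_family 2 (\<lambda>n x. (- (b * u)) ^ n * (C * exp (- (b * u) * x)))"
      using u assms by (intro cm_family_exp) (auto simp: C_def)
    fix w :: real assume "w > 2"
    then show "(- (b * u)) ^ 0 * (C * exp (- (b * u) * w)) =
        gamma_density \<alpha> b (u * hcm_v w) * gamma_density \<alpha> b (u / hcm_v w)"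
      using gamma_density_mult[OF u, of "hcm_v w" \<alpha> b] hcm_v_gt_1[of w] hcm_v_add_inverse[of w]
      by (simp add: C_def)
  qed
qed (use assms gamma_density_pos in auto)

lemma prob_density_pos_gamma_density:
  assumes "\<alpha> > 0" "b > 0"
  shows "prob_density_pos (gamma_density \<alpha> b)"
  unfolding prob_density_pos_def
proof (intro conjI allI impI)
  let ?f = "\<lambda>t. t powr (\<alpha> - 1) / exp t"
  have "(?f has_integral Gamma \<alpha>) (interior {0..})"
    using Gamma_integral_real[OF assms(1)]
    by (subst has_integral_interior) (auto intro: negligible_convex_frontier)
  then have "(?f has_integral Gamma \<alpha>) {0<..}" by simp
  moreover have "((*) b) ` {0<..} = {0<..}"
    using assms(2) by (auto intro!: image_eqI[of _ _ "y / b" for y])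
  \<comment> \<open>Nonnegativity upgrades integrability to absolute integrability, as the change of
    variables t = b x demands.\<close>
  ultimately have "?f absolutely_integrable_on ((*) b) ` {0<..} \<and> integral (((*) b) ` {0<..}) ?f = Gamma \<alpha>"
    by (auto simp: has_integral_integrable_integral intro!: nonnegative_absolutely_integrable_1)
  then have "(\<lambda>x. \<bar>b\<bar> * ?f (b * x)) absolutely_integrable_on {0<..} \<and>
      integral {0<..} (\<lambda>x. \<bar>b\<bar> * ?f (b * x)) = Gamma \<alpha>"
    using assms(2)
    by (subst has_absolute_integral_change_of_variables_1')
      (auto intro!: derivative_eq_intros inj_onI)
  then have "((\<lambda>x. \<bar>b\<bar> * ?f (b * x)) has_integral Gamma \<alpha>) {0<..}"
    by (simp add: has_integral_integrable_integral set_lebesgue_integral_eq_integral)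
  then have int: "((\<lambda>x. 1 / Gamma \<alpha> * (\<bar>b\<bar> * ?f (b * x))) has_integral 1 / Gamma \<alpha> * Gamma \<alpha>) {0<..}"
    by (rule has_integral_mult_right)
  have "1 / Gamma \<alpha> * (\<bar>b\<bar> * ?f (b * x)) = gamma_density \<alpha> b x" if "x \<in> {0<..}" for x
  proof -
    have "b powr \<alpha> = b * b powr (\<alpha> - 1)"
      using assms(2) powr_mult_base[of b "\<alpha> - 1"] by simp
    then show ?thesis
      using that assms(2) by (simp add: gamma_density_def powr_mult exp_minus divide_inverse)
  qed
  then have "(gamma_density \<alpha> b has_integral 1 / Gamma \<alpha> * Gamma \<alpha>) {0<..}"
    using int by (rule has_integral_eq)
  then show "(gamma_density \<alpha> b has_integral 1) {0<..}"
    using less_imp_neq[OF Gamma_real_pos[OF assms(1)]] by simp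
qed (use assms gamma_density_pos in \<open>auto intro: less_imp_le\<close>)

text \<open>With Gamma(a + m) = (a)_m Gamma(a), the extra powers of \<open>b\<close>,
  \<open>\<theta>\<close> and \<open>x\<close> combine into the m-th power of the argument of the
  hypergeometric series.\<close>

lemma poisson_gamma_term:
  assumes "a > 0" "b > 0" "x > 0"
  shows "exp (- \<theta>) * (\<theta> ^ m / fact m * gamma_density (a + real m) b x) =
    exp (- \<theta>) * gamma_density a b x * ((b * \<theta> * x) ^ m / (fact m * pochhammer a m))"
proof -
  have "a \<notin> \<int>\<^sub>\<le>\<^sub>0" using assms by (auto elim!: nonpos_Ints_cases)
  then have G: "Gamma (a + real m) = pochhammer a m * Gamma a"
    using Gamma_real_pos[OF assms(1)] by (simp add: pochhammer_Gamma)
  have "b powr (a + real m) = b powr a * b ^ m" "x powr (a + real m - 1) = x powr (a - 1) * x ^ m"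
    using assms powr_add[of x "a - 1" "real m"] by (simp_all add: powr_add powr_realpow algebra_simps)
  then show ?thesis
    by (simp add: gamma_density_def G power_mult_distrib mult_ac)
qed

lemma p_mix_eq:
  "p_mix a b \<theta> x = exp (- \<theta>) * gamma_density a b x * hyp_0F1 a (b * \<theta> * x)"
  by (simp add: p_mix_def gamma_density_def)

lemma p_mix_sums:
  assumes "a > 0" "b > 0" "x > 0"
  shows "(\<lambda>m. exp (- \<theta>) * (\<theta> ^ m / fact m * gamma_density (a + real m) b x)) sums p_mix a b \<theta> x"
  unfolding poisson_gamma_term[OF assms] p_mix_eq hyp_0F1_def
  by (intro sums_mult summable_sums summable_hyp_0F1 assms)

lemma p_mix_pos:
  assumes "a > 0" "b > 0" "\<theta> > 0" "x > 0"
  shows "p_mix a b \<theta> x > 0"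
proof -
  have "1 + b * \<theta> * x / a \<le> hyp_0F1 a (b * \<theta> * x)"
    using assms by (intro hyp_0F1_ge) auto
  moreover have "b * \<theta> * x / a > 0" using assms by simp
  ultimately have "hyp_0F1 a (b * \<theta> * x) > 0" by linarith
  then show ?thesis
    using gamma_density_pos[of a b x] assms by (simp add: p_mix_eq)
qed

text \<open>Monotone convergence applies to the partial sums of the mixture: their integrals are
  partial sums of the Poisson weights, which tend to 1.\<close>

lemma prob_density_pos_p_mix:
  assumes "a > 0" "b > 0" "\<theta> > 0"
  shows "prob_density_pos (p_mix a b \<theta>)"
  unfolding prob_density_pos_def
proof (intro conjI allI impI)
  let ?f = "\<lambda>k x. \<Sum>m<k. exp (- \<theta>) * (\<theta> ^ m / fact m * gamma_density (a + real m) b x)"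
  show "(p_mix a b \<theta> has_integral 1) {0<..}"
  proof (rule has_integral_monotone_convergence_increasing)
    fix k
    show "(?f k has_integral (\<Sum>m<k. exp (- \<theta>) * (\<theta> ^ m / fact m * 1))) {0<..}"
      using assms prob_density_pos_gamma_density[of "a + real m" b for m]
      by (intro has_integral_sum has_integral_mult_right)
        (auto simp: prob_density_pos_def add_pos_nonneg)
  next
    fix k and x :: real assume "x \<in> {0<..}"
    then show "?f k x \<le> ?f (Suc k) x"
      using assms gamma_density_pos[of "a + real k" b x] by (simp add: add_pos_nonneg)
  next
    fix x :: real assume "x \<in> {0<..}"
    then show "(\<lambda>k. ?f k x) \<longlonglongrightarrow> p_mix a b \<theta> x"
      using p_mix_sums[OF assms(1,2), of x \<theta>] by (simp add: sums_def)
  next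
    have "(\<lambda>m. exp (- \<theta>) * (\<theta> ^ m / fact m * 1)) sums (exp (- \<theta>) * exp \<theta>)"
      using exp_converges[of \<theta>] by (intro sums_mult) (simp add: field_simps)
    then show "(\<lambda>k. \<Sum>m<k. exp (- \<theta>) * (\<theta> ^ m / fact m * 1)) \<longlonglongrightarrow> 1"
      by (simp add: sums_def flip: exp_add)
  qed
qed (use assms p_mix_pos in \<open>auto intro: less_imp_le\<close>)

section \<open>Failure of hyperbolic complete monotonicity for the mixture\<close>

lemma not_HCM_p_mix:
  assumes "a > 0" "b > 0" "\<theta> > 0"
  shows "\<not> HCM (p_mix a b \<theta>)"
proof
  assume "HCM (p_mix a b \<theta>)"
  define c where "c = b * \<theta>"
  have c: "c > 0" using assms by (simp add: c_def)
  \<comment> \<open>The factor \<open>1 *\<close> keeps the exact shape of the definition of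
    \<open>HCM\<close> at u = 1.\<close>
  define H where "H w = p_mix a b \<theta> (1 * hcm_v w) * p_mix a b \<theta> (1 / hcm_v w)" for w
  define G where "G w = hyp_0F1 a (c * hcm_v w) * hyp_0F1 a (c / hcm_v w)" for w
  define C where "C = (exp (- \<theta>) * (b powr a / Gamma a))\<^sup>2"
  have "C > 0" using assms(2) less_imp_neq[OF Gamma_real_pos[OF assms(1)]] by (simp add: C_def)
  have H_eq: "H w = C * exp (- b * w) * G w" if "w > 2" for w
  proof -
    have "H w = (exp (- \<theta>))\<^sup>2 * (gamma_density a b (1 * hcm_v w) * gamma_density a b (1 / hcm_v w)) * G w"
      by (simp add: H_def G_def p_mix_eq c_def power2_eq_square)
    also have "\<dots> = C * exp (- b * w) * G w"
      using gamma_density_mult[OF zero_less_one, of "hcm_v w" a b]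
        hcm_v_gt_1[OF that] hcm_v_add_inverse[OF that]
      by (simp add: C_def power_mult_distrib power_divide)
    finally show ?thesis .
  qed
  have "completely_monotone_on {2<..} H"
    using \<open>HCM _\<close> zero_less_one unfolding HCM_def H_def by blast
  note convex_H = completely_monotone_on_log_convex[OF this]
  have F_ge: "1 + y / a \<le> hyp_0F1 a y" "1 \<le> hyp_0F1 a y" if "y \<ge> 0" for y
  proof -
    show "1 + y / a \<le> hyp_0F1 a y" by (rule hyp_0F1_ge) (use assms that in auto)
    moreover have "y / a \<ge> 0" using assms that by simp
    ultimately show "1 \<le> hyp_0F1 a y" by linarith
  qed
  \<comment> \<open>The factor at \<open>c / hcm_v w\<close> is at least 1, and the other grows at
    least linearly in \<open>hcm_v w \<ge> w / 2\<close>.\<close>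
  have G_ge: "1 + c * w / (2 * a) \<le> G w" if "w > 2" for w
  proof -
    have v: "hcm_v w > 1" "w / 2 \<le> hcm_v w" using hcm_v_gt_1[OF that] hcm_v_bounds[OF that] by auto
    have "1 + c * w / (2 * a) = 1 + c * (w / 2) / a" by simp
    also have "\<dots> \<le> 1 + c * hcm_v w / a"
      using v c assms by (intro add_left_mono divide_right_mono mult_left_mono) auto
    also have "\<dots> \<le> hyp_0F1 a (c * hcm_v w) * 1"
      using F_ge(1)[of "c * hcm_v w"] v c by simp
    also have "\<dots> \<le> G w"
      unfolding G_def using F_ge(2)[of "c * hcm_v w"] F_ge(2)[of "c / hcm_v w"] v c
      by (intro mult_left_mono) auto
    finally show ?thesis .
  qed
  have G_pos: "G w > 0" if "w > 2" for w
  proof -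
    have "c * w / (2 * a) > 0" using that c assms by simp
    then show ?thesis using G_ge[OF that] by linarith
  qed
  have convex_G: "(G (w + h))\<^sup>2 \<le> G w * G (w + 2 * h)" if "w > 2" "h > 0" for w h
  proof -
    have "H w > 0" using H_eq G_pos \<open>C > 0\<close> that by simp
    from convex_H[OF that(2,1) this]
    have "(C * exp (- b * (w + h)) * G (w + h))\<^sup>2 \<le>
        (C * exp (- b * w) * G w) * (C * exp (- b * (w + 2 * h)) * G (w + 2 * h))"
      using that by (simp only: H_eq[of "w + h"] H_eq[of w] H_eq[of "w + 2 * h"])
    also have "\<dots> = C\<^sup>2 * (exp (- b * w) * exp (- b * (w + 2 * h))) * (G w * G (w + 2 * h))"
      by (simp add: power2_eq_square)
    \<comment> \<open>The exponential satisfies log-convexity with equality, so it cancels and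
      leaves the inequality for \<open>G\<close>.\<close>
    also have "exp (- b * w) * exp (- b * (w + 2 * h)) = (exp (- b * (w + h)))\<^sup>2"
      by (simp add: power2_eq_square algebra_simps flip: exp_add)
    finally have "(C * exp (- b * (w + h)))\<^sup>2 * (G (w + h))\<^sup>2 \<le>
        (C * exp (- b * (w + h)))\<^sup>2 * (G w * G (w + 2 * h))"
      by (simp only: power_mult_distrib)
    then show ?thesis using \<open>C > 0\<close> by simp
  qed
  \<comment> \<open>The base point 3 is an arbitrary point beyond 2. The step solves
    \<open>c * h / (2 * a) = G 3\<close>, so the linear lower bound at \<open>3 + h\<close> already
    exceeds \<open>G 3\<close>.\<close>
  define h where "h = 2 * a * G 3 / c"
  have h: "h > 0" using assms c G_pos[of 3] by (simp add: h_def)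
  define \<rho> where "\<rho> = G (3 + h) / G 3"
  have "G 3 < G (3 + h)"
  proof -
    have "c * (3 + h) / (2 * a) = c * 3 / (2 * a) + G 3"
      using assms c by (simp add: h_def field_simps)
    moreover have "c * 3 / (2 * a) > 0" using assms c by simp
    ultimately show ?thesis using G_ge[of "3 + h"] h by linarith
  qed
  then have \<rho>: "\<rho> > 1" using G_pos[of 3] by (simp add: \<rho>_def)
  have lower: "G 3 * \<rho> ^ k \<le> G (3 + real k * h)" for k
  proof -
    have gt: "3 + real k * h > 2" for k using h by (simp add: add_strict_increasing)
    have "G (3 + real 0 * h) * (G (3 + real 1 * h) / G (3 + real 0 * h)) ^ k \<le> G (3 + real k * h)"
      by (rule log_convex_sequence_growth)
        (use G_pos gt convex_G[OF gt h] in \<open>auto simp: algebra_simps\<close>)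
    then show ?thesis by (simp add: \<rho>_def)
  qed
  \<comment> \<open>Chosen so that the upper bound on \<open>G\<close> grows by the square root of
    \<open>\<rho>\<close> per step of length \<open>h\<close>, against at least
    \<open>\<rho>\<close> for the lower bound.\<close>
  define \<epsilon> where "\<epsilon> = ln \<rho> / (2 * c * h)"
  have "\<epsilon> > 0" using \<rho> c h by (simp add: \<epsilon>_def)
  then obtain K where "K > 0" and K: "\<And>z. z \<ge> 0 \<Longrightarrow> hyp_0F1 a z \<le> K * exp (\<epsilon> * z)"
    using hyp_0F1_subexponential[OF assms(1)] by metis
  have G_le: "G w \<le> K * exp (\<epsilon> * (c * w)) * hyp_0F1 a c" if "w > 2" for w
  proof -
    have v: "hcm_v w > 1" "hcm_v w \<le> w" using hcm_v_gt_1[OF that] hcm_v_bounds[OF that] by auto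
    have "hyp_0F1 a (c * hcm_v w) \<le> hyp_0F1 a (c * w)"
      using v c assms by (intro hyp_0F1_mono) auto
    also have "\<dots> \<le> K * exp (\<epsilon> * (c * w))" using that c by (intro K) auto
    finally have 1: "hyp_0F1 a (c * hcm_v w) \<le> K * exp (\<epsilon> * (c * w))" .
    \<comment> \<open>Since \<open>hcm_v w > 1\<close>, the second factor stays below a constant;
      all growth comes from the first.\<close>
    have 2: "hyp_0F1 a (c / hcm_v w) \<le> hyp_0F1 a c"
      using v c assms by (intro hyp_0F1_mono) (auto simp: field_simps)
    show ?thesis
      unfolding G_def using 1 2 F_ge(2)[of "c / hcm_v w"] v c \<open>K > 0\<close>
      by (intro mult_mono) auto
  qed
  define A where "A = K * exp (\<epsilon> * (c * 3)) * hyp_0F1 a c"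
  \<comment> \<open>Comparing both bounds on \<open>G (3 + real k * h)\<close> and cancelling
    \<open>q ^ k\<close>, with \<open>q\<close> the square root of \<open>\<rho>\<close>, bounds a
    geometric sequence of ratio above 1 by a constant free of \<open>k\<close>.\<close>
  have bound: "G 3 * exp (ln \<rho> / 2) ^ k \<le> A" for k
  proof -
    define q where "q = exp (ln \<rho> / 2)"
    have q2: "\<rho> = q * q" using \<rho> by (simp add: q_def flip: exp_add)
    have "q > 0" by (simp add: q_def)
    have "3 + real k * h > 2" using h by (simp add: add_strict_increasing)
    from G_le[OF this] lower[of k]
    have "G 3 * \<rho> ^ k \<le> K * exp (\<epsilon> * (c * (3 + real k * h))) * hyp_0F1 a c" by linarith
    also have "\<epsilon> * (c * (3 + real k * h)) = \<epsilon> * (c * 3) + real k * (ln \<rho> / 2)"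
      using c h by (simp add: \<epsilon>_def field_simps)
    also have "K * exp (\<epsilon> * (c * 3) + real k * (ln \<rho> / 2)) * hyp_0F1 a c = A * q ^ k"
      by (simp add: A_def q_def exp_add exp_of_nat_mult[symmetric])
    finally have "(G 3 * q ^ k) * q ^ k \<le> A * q ^ k"
      by (simp add: q2 power_mult_distrib mult.assoc)
    then show ?thesis using \<open>q > 0\<close> by (simp add: q_def)
  qed
  have "exp (ln \<rho> / 2) > 1" using \<rho> by simp
  then obtain k where "A / G 3 < exp (ln \<rho> / 2) ^ k"
    using real_arch_pow by blast
  then have "A < G 3 * exp (ln \<rho> / 2) ^ k"
    using G_pos[of 3] by (simp add: field_simps)
  with bound[of k] show False by linarith
qed

theorem corollary2:
  fixes a b \<theta> :: real
  assumes "a > 0" and "b > 0" and "\<theta> > 0"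
  shows "(\<forall>x>0. summable (\<lambda>m. \<theta> ^ m / fact m * gamma_density (a + real m) b x) \<and>
            p_mix a b \<theta> x = exp (- \<theta>) * (\<Sum>m. \<theta> ^ m / fact m * gamma_density (a + real m) b x))
       \<and> (\<forall>m. prob_density_pos (gamma_density (a + real m) b) \<and> HCM (gamma_density (a + real m) b))
       \<and> prob_density_pos (p_mix a b \<theta>) \<and> (\<forall>x>0. p_mix a b \<theta> x > 0)
       \<and> \<not> HCM (p_mix a b \<theta>)"
proof -
  have "summable (\<lambda>m. \<theta> ^ m / fact m * gamma_density (a + real m) b x) \<and>
      p_mix a b \<theta> x = exp (- \<theta>) * (\<Sum>m. \<theta> ^ m / fact m * gamma_density (a + real m) b x)"
    if "x > 0" for x
  proof -
    note sums = p_mix_sums[OF assms(1,2) that, of \<theta>]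
    have summable: "summable (\<lambda>m. \<theta> ^ m / fact m * gamma_density (a + real m) b x)"
      using sums_summable[OF sums] by (subst (asm) summable_cmult_iff) auto
    moreover have "p_mix a b \<theta> x = exp (- \<theta>) * (\<Sum>m. \<theta> ^ m / fact m * gamma_density (a + real m) b x)"
      using sums_unique[OF sums] suminf_mult[OF summable] by simp
    ultimately show ?thesis by blast
  qed
  moreover have "prob_density_pos (gamma_density (a + real m) b)" "HCM (gamma_density (a + real m) b)" for m
    using assms by (simp_all add: prob_density_pos_gamma_density HCM_gamma_density add_pos_nonneg)
  ultimately show ?thesis
    using prob_density_pos_p_mix[OF assms] p_mix_pos[OF assms] not_HCM_p_mix[OF assms] by simp
qed

end
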